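(* Let $U=(u_{ij})_{i,j\in\mathbb{Z}}$ be a $\mathbb{Z}\times\mathbb{Z}$ matrix whose scalar entries depend on $\bar{\boldsymbol{t}}=(t_{-1},t_{-2},\ldots)$ and which satisfies $$\frac{\partial U}{\partial t_{-k}}=\Lambda^{-k}U-U\Lambda^{k}-U\mathcal{O}_{-k}U,\qquad k=1,2,\ldots.$$ Then the matrix $\bar g=E-U\bar\Omega$ satisfies $$\frac{\partial\bar g}{\partial t_{-k}}=(\Lambda^{-k}-U\mathcal{O}_{-k})\bar g-\bar g\Lambda^{-k},\qquad k=1,2,\ldots.$$
   Context: All matrices are indexed by $\mathbb{Z}\times\mathbb{Z}$; $E_{ij}$ is the matrix unit and $E$ the unit matrix. For $k\in\mathbb{Z}$, $\Lambda^k=\sum_{i\in\mathbb{Z}}E_{i,i+k}$. For $k\ge1$, $\mathcal{O}_{-k}=-\sum_{l=1}^kE_{-l,l-k-1}$. Also $\bar\Omega=-\sum_{i=0}^\infty E_{-i-1,i}$. All matrix products involve only finite sums in each entry. Derivatives of matrices are entrywise. *)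

theory Defs
  imports Complex_Main "HOL-Library.Groups_Big_Fun"
begin

type_synonym 'a zmat = "int \<Rightarrow> int \<Rightarrow> 'a"

text \<open>
  Difference and negation of matrices are the pointwise operations on functions. Possibly infinite
  sums are taken entrywise with \<^const>\<open>Sum_any\<close>, which is \<open>0\<close> on summands of infinite support; the
  finiteness lemmas below show that this default value is never used.
\<close>

definition unit_zmat :: "int \<Rightarrow> int \<Rightarrow> 'a::comm_ring_1 zmat" where
  "unit_zmat i j = (\<lambda>a b. of_bool (a = i \<and> b = j))"

definition one_zmat :: "'a::comm_ring_1 zmat" where
  "one_zmat = (\<lambda>a b. of_bool (a = b))"

definition times_zmat :: "'a::comm_ring_1 zmat \<Rightarrow> 'a zmat \<Rightarrow> 'a zmat"  (infixl "\<star>" 70) where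
  "A \<star> B = (\<lambda>i j. \<Sum>l. A i l * B l j)"

definition Lambda_pow :: "int \<Rightarrow> 'a::comm_ring_1 zmat" where
  "Lambda_pow k = (\<lambda>a b. \<Sum>i. unit_zmat i (i + k) a b)"

text \<open>\<open>O_neg k\<close> is $\mathcal{O}_{-k}$.\<close>

definition O_neg :: "nat \<Rightarrow> 'a::comm_ring_1 zmat" where
  "O_neg k = (\<lambda>a b. - (\<Sum>l=1..int k. unit_zmat (- l) (l - int k - 1) a b))"

definition Omega_bar :: "'a::comm_ring_1 zmat" where
  "Omega_bar = (\<lambda>a b. - (\<Sum>i::nat. unit_zmat (- int i - 1) (int i) a b))"

text \<open>
  A point \<open>t :: nat \<Rightarrow> 'a\<close> encodes $(t_{-1}, t_{-2}, \ldots)$ by \<open>t k\<close> $= t_{-k}$ for \<open>k \<ge> 1\<close>; no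
  derivative is ever taken in the spare coordinate \<open>t 0\<close>. The predicate says that every entry of
  \<open>F\<close> is differentiable in $t_{-k}$ at the point \<open>t\<close>, and that \<open>D\<close> is the matrix of these partial
  derivatives.
\<close>

definition has_partial_deriv_zmat ::
    "((nat \<Rightarrow> 'a::real_normed_field) \<Rightarrow> 'a zmat) \<Rightarrow> nat \<Rightarrow> 'a zmat \<Rightarrow> (nat \<Rightarrow> 'a) \<Rightarrow> bool" where
  "has_partial_deriv_zmat F k D t \<longleftrightarrow>
     (\<forall>i j. ((\<lambda>s. F (t(k := s)) i j) has_field_derivative D i j) (at (t k)))"

definition g_bar :: "'a::comm_ring_1 zmat \<Rightarrow> 'a zmat" where
  "g_bar U = one_zmat - U \<star> Omega_bar"


lemma finite_support_Lambda_pow: "finite {i. unit_zmat i (i + k) a b \<noteq> (0::'a::comm_ring_1)}"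
  by (rule finite_subset[of _ "{a}"]) (auto simp: unit_zmat_def)

lemma finite_support_Omega_bar:
  "finite {i::nat. unit_zmat (- int i - 1) (int i) a b \<noteq> (0::'a::comm_ring_1)}"
  by (rule finite_subset[of _ "{nat b}"]) (auto simp: unit_zmat_def)

lemma Lambda_pow_entry: "(Lambda_pow k :: 'a::comm_ring_1 zmat) a b = of_bool (b = a + k)"
proof -
  have "(Lambda_pow k :: 'a zmat) a b = (\<Sum>i\<in>{a}. unit_zmat i (i + k) a b)"
    unfolding Lambda_pow_def
    by (rule Sum_any.expand_superset) (auto simp: unit_zmat_def)
  then show ?thesis by (simp add: unit_zmat_def)
qed

lemma Omega_bar_entry:
  "(Omega_bar :: 'a::comm_ring_1 zmat) a b = - of_bool (b \<ge> 0 \<and> a = - b - 1)"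
proof -
  have "(Omega_bar :: 'a zmat) a b = - (\<Sum>i\<in>{nat b}. unit_zmat (- int i - 1) (int i) a b)"
    unfolding Omega_bar_def
    by (subst Sum_any.expand_superset[of "{nat b}"]) (auto simp: unit_zmat_def)
  then show ?thesis by (auto simp: unit_zmat_def)
qed

lemma O_neg_entry:
  "(O_neg k :: 'a::comm_ring_1 zmat) a b =
     - of_bool (- int k \<le> a \<and> a \<le> - 1 \<and> a + b = - int k - 1)"
proof -
  have "(\<Sum>l=1..int k. unit_zmat (- l) (l - int k - 1) a b :: 'a) =
        (\<Sum>l=1..int k. if l = - a then of_bool (a + b = - int k - 1) else 0)"
    by (rule sum.cong) (auto simp: unit_zmat_def)
  then show ?thesis by (simp add: O_neg_def) fastforce
qed

text \<open>
  Every product in the two matrix equations has a left factor with finite rows or a right factor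
  with finite columns, and hence only finite sums in its entries.
\<close>

definition row_finite :: "'a::comm_ring_1 zmat \<Rightarrow> bool" where
  "row_finite A \<longleftrightarrow> (\<forall>i. finite {l. A i l \<noteq> 0})"

definition col_finite :: "'a::comm_ring_1 zmat \<Rightarrow> bool" where
  "col_finite A \<longleftrightarrow> (\<forall>j. finite {l. A l j \<noteq> 0})"

lemma finite_support_times_zmat:
  assumes "row_finite A \<or> col_finite B"
  shows "finite {l. A i l * B l j \<noteq> 0}"
  using assms
proof
  assume "row_finite A"
  then have "finite {l. A i l \<noteq> 0}" by (simp add: row_finite_def)
  then show ?thesis by (rule rev_finite_subset) auto
next
  assume "col_finite B"
  then have "finite {l. B l j \<noteq> 0}" by (simp add: col_finite_def)
  then show ?thesis by (rule rev_finite_subset) auto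
qed

lemma row_finite_Lambda_pow: "row_finite (Lambda_pow k :: 'a::comm_ring_1 zmat)"
  unfolding row_finite_def
proof
  fix i
  have "{l. (Lambda_pow k :: 'a zmat) i l \<noteq> 0} \<subseteq> {i + k}" by (auto simp: Lambda_pow_entry)
  then show "finite {l. (Lambda_pow k :: 'a zmat) i l \<noteq> 0}" by (rule finite_subset) simp
qed

lemma col_finite_Lambda_pow: "col_finite (Lambda_pow k :: 'a::comm_ring_1 zmat)"
  unfolding col_finite_def
proof
  fix j
  have "{l. (Lambda_pow k :: 'a zmat) l j \<noteq> 0} \<subseteq> {j - k}" by (auto simp: Lambda_pow_entry)
  then show "finite {l. (Lambda_pow k :: 'a zmat) l j \<noteq> 0}" by (rule finite_subset) simp
qed

lemma col_finite_O_neg: "col_finite (O_neg k :: 'a::comm_ring_1 zmat)"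
  unfolding col_finite_def
proof
  fix j
  have "{l. (O_neg k :: 'a zmat) l j \<noteq> 0} \<subseteq> {- int k..- 1}" by (auto simp: O_neg_entry)
  then show "finite {l. (O_neg k :: 'a zmat) l j \<noteq> 0}" by (rule finite_subset) simp
qed

lemma col_finite_Omega_bar: "col_finite (Omega_bar :: 'a::comm_ring_1 zmat)"
  unfolding col_finite_def
proof
  fix j
  have "{l. (Omega_bar :: 'a zmat) l j \<noteq> 0} \<subseteq> {- j - 1}" by (auto simp: Omega_bar_entry)
  then show "finite {l. (Omega_bar :: 'a zmat) l j \<noteq> 0}" by (rule finite_subset) simp
qed

lemma row_finite_times_O_neg:
  fixes U :: "'a::comm_ring_1 zmat"
  shows "row_finite (U \<star> O_neg k)"
proof -
  have "(U \<star> O_neg k) i j = 0" if "j \<notin> {- int k..- 1}" for i j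
  proof -
    have "O_neg k l j = (0::'a)" for l
      using that unfolding O_neg_entry by fastforce
    then show ?thesis by (simp add: times_zmat_def)
  qed
  then have "{j. (U \<star> O_neg k) i j \<noteq> 0} \<subseteq> {- int k..- 1}" for i by blast
  then show ?thesis
    unfolding row_finite_def by (meson finite_atLeastAtMost_int finite_subset)
qed

lemma row_finite_diff:
  assumes "row_finite A" "row_finite B"
  shows "row_finite (A - B)"
  unfolding row_finite_def
proof
  fix i
  have "{l. (A - B) i l \<noteq> 0} \<subseteq> {l. A i l \<noteq> 0} \<union> {l. B i l \<noteq> 0}" by auto
  then show "finite {l. (A - B) i l \<noteq> 0}"
    using assms unfolding row_finite_def by (meson finite_UnI finite_subset)
qed

end

theory Submission imports Defs begin

text \<open>
  Since $\bar g$ depends on $t$ only through $U$, its derivative is $-(\partial U)\bar\Omega$. The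
  claim is then matrix algebra around the single relation
  $\Lambda^k\bar\Omega = \bar\Omega\Lambda^{-k} - \mathcal{O}_{-k}$: right multiplication by
  $\Lambda^{-k}$ moves every entry $k$ columns to the left, and $\mathcal{O}_{-k}$ collects those
  pushed into the negative columns.
\<close>

text \<open>\<open>Sum_any\<close> defaults to 0 on infinite support, so subtractivity can fail
  without finiteness. With it, all three sums run over the union of the two supports.\<close>

lemma Sum_any_diff:
  fixes f g :: "'b \<Rightarrow> 'a::ab_group_add"
  assumes "finite {l. f l \<noteq> 0}" "finite {l. g l \<noteq> 0}"
  shows "(\<Sum>l. f l - g l) = (\<Sum>l. f l) - (\<Sum>l. g l)"
proof -
  let ?S = "{l. f l \<noteq> 0} \<union> {l. g l \<noteq> 0}"
  have S: "finite ?S" using assms by simp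
  have "(\<Sum>l. f l - g l) = (\<Sum>l\<in>?S. f l - g l)"
    by (rule Sum_any.expand_superset[OF S]) auto
  also have "\<dots> = (\<Sum>l\<in>?S. f l) - (\<Sum>l\<in>?S. g l)"
    by (rule sum_subtractf)
  also have "(\<Sum>l\<in>?S. f l) = (\<Sum>l. f l)"
    by (rule Sum_any.expand_superset[OF S, symmetric]) auto
  also have "(\<Sum>l\<in>?S. g l) = (\<Sum>l. g l)"
    by (rule Sum_any.expand_superset[OF S, symmetric]) auto
  finally show ?thesis .
qed

lemma times_zmat_diff_right:
  assumes "row_finite A \<or> col_finite B \<and> col_finite C"
  shows "A \<star> (B - C) = A \<star> B - A \<star> C"
proof (intro ext)
  fix i j
  have "finite {l. A i l * B l j \<noteq> 0}" "finite {l. A i l * C l j \<noteq> 0}"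
    using assms by (blast intro: finite_support_times_zmat)+
  then show "(A \<star> (B - C)) i j = (A \<star> B - A \<star> C) i j"
    by (simp add: times_zmat_def right_diff_distrib Sum_any_diff)
qed

lemma times_zmat_diff_left:
  assumes "row_finite A \<and> row_finite B \<or> col_finite C"
  shows "(A - B) \<star> C = A \<star> C - B \<star> C"
proof (intro ext)
  fix i j
  have "finite {l. A i l * C l j \<noteq> 0}" "finite {l. B i l * C l j \<noteq> 0}"
    using assms by (blast intro: finite_support_times_zmat)+
  then show "((A - B) \<star> C) i j = (A \<star> C - B \<star> C) i j"
    by (simp add: times_zmat_def left_diff_distrib Sum_any_diff)
qed

text \<open>Finiteness of column \<open>j\<close> of \<open>C\<close> and of the sums in
  \<open>A \<star> B\<close> confines the double sum to a finite rectangle \<open>L\<close> x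
  \<open>S\<close>, where the order of summation can be exchanged.\<close>

lemma times_zmat_assoc:
  fixes A B C :: "'a::comm_ring_1 zmat"
  assumes C: "col_finite C" and AB: "row_finite A \<or> col_finite B"
  shows "(A \<star> B) \<star> C = A \<star> (B \<star> C)"
proof (intro ext)
  fix i j
  define S where "S = {m. C m j \<noteq> 0}"
  \<comment> \<open>One finite range for \<open>l\<close> that serves all \<open>m \<in> S\<close>
    at once.\<close>
  define L where "L = (\<Union>m\<in>S. {l. A i l * B l m \<noteq> 0})"
  have S: "finite S"
    using C by (simp add: S_def col_finite_def)
  have L: "finite L"
    using S AB by (auto simp: L_def intro!: finite_support_times_zmat)
  have AB_eq: "(A \<star> B) i m = (\<Sum>l\<in>L. A i l * B l m)" if "m \<in> S" for m
    unfolding times_zmat_def using that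
    by (intro Sum_any.expand_superset L) (auto simp: L_def)
  have BC_eq: "(B \<star> C) l j = (\<Sum>m\<in>S. B l m * C m j)" for l
    unfolding times_zmat_def
    by (intro Sum_any.expand_superset S) (auto simp: S_def)
  have zero: "A i l * (B \<star> C) l j = 0" if "l \<notin> L" for l
  proof -
    have "A i l * B l m = 0" if "m \<in> S" for m
      using \<open>l \<notin> L\<close> that by (auto simp: L_def)
    then show ?thesis
      by (simp add: BC_eq sum_distrib_left mult.assoc[symmetric])
  qed
  have "((A \<star> B) \<star> C) i j = (\<Sum>m\<in>S. (A \<star> B) i m * C m j)"
    unfolding times_zmat_def[of "A \<star> B"]
    by (intro Sum_any.expand_superset S) (auto simp: S_def)
  also have "\<dots> = (\<Sum>m\<in>S. \<Sum>l\<in>L. A i l * B l m * C m j)"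
    by (simp add: AB_eq sum_distrib_right)
  also have "\<dots> = (\<Sum>l\<in>L. \<Sum>m\<in>S. A i l * B l m * C m j)"
    by (rule sum.swap)
  also have "\<dots> = (\<Sum>l\<in>L. A i l * (B \<star> C) l j)"
    by (simp add: BC_eq sum_distrib_left mult.assoc)
  also have "\<dots> = (A \<star> (B \<star> C)) i j"
    unfolding times_zmat_def[of A]
    by (intro Sum_any.expand_superset[symmetric] L) (use zero in blast)
  finally show "((A \<star> B) \<star> C) i j = (A \<star> (B \<star> C)) i j" .
qed

lemma Lambda_pow_times_entry: "(Lambda_pow k \<star> A) i j = A (i + k) j"
proof -
  have "(Lambda_pow k \<star> A) i j = (\<Sum>l\<in>{i + k}. Lambda_pow k i l * A l j)"
    unfolding times_zmat_def
    by (intro Sum_any.expand_superset) (auto simp: Lambda_pow_entry)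
  then show ?thesis by (simp add: Lambda_pow_entry)
qed

lemma times_Lambda_pow_entry: "(A \<star> Lambda_pow k) i j = A i (j - k)"
proof -
  have "(A \<star> Lambda_pow k) i j = (\<Sum>l\<in>{j - k}. A i l * Lambda_pow k l j)"
    unfolding times_zmat_def
    by (intro Sum_any.expand_superset) (auto simp: Lambda_pow_entry)
  then show ?thesis by (simp add: Lambda_pow_entry)
qed

text \<open>Column \<open>j\<close> of \<open>Omega_bar\<close> is zero for \<open>j < 0\<close> and
  otherwise has its only nonzero entry, -1, in row \<open>- j - 1\<close>.\<close>

lemma times_Omega_bar_entry:
  "(A \<star> Omega_bar) i j = - (A i (- j - 1) * of_bool (j \<ge> 0))"
proof -
  have "(A \<star> Omega_bar) i j = (\<Sum>l\<in>{- j - 1}. A i l * Omega_bar l j)"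
    unfolding times_zmat_def
    by (intro Sum_any.expand_superset) (auto simp: Omega_bar_entry)
  then show ?thesis by (simp add: Omega_bar_entry)
qed

lemma one_zmat_eq_Lambda_pow: "one_zmat = Lambda_pow 0"
  by (intro ext) (auto simp: one_zmat_def Lambda_pow_entry)

text \<open>All three matrices have entries -1 on parts of the antidiagonal
  \<open>a + b = - k - 1\<close>, and 0 elsewhere. The columns are \<open>b \<ge> 0\<close> on the
  left, and \<open>b \<ge> - k\<close> and \<open>- k \<le> b \<le> - 1\<close> on the
  right.\<close>

lemma Lambda_pow_times_Omega_bar:
  "Lambda_pow (int k) \<star> Omega_bar = Omega_bar \<star> Lambda_pow (- int k) - O_neg k"
  by (intro ext)
    (auto simp: Lambda_pow_times_entry times_Lambda_pow_entry Omega_bar_entry O_neg_entry)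

lemma col_finite_Omega_bar_times_Lambda_pow:
  "col_finite (Omega_bar \<star> Lambda_pow k :: 'a::comm_ring_1 zmat)"
  using col_finite_Omega_bar by (auto simp: col_finite_def times_Lambda_pow_entry)

text \<open>After expansion, the terms with \<open>Lambda_pow (- int k) \<star> U\<close> and
  \<open>U \<star> O_neg k \<star> U\<close> agree on both sides. What remains is
  \<open>Lambda_pow_times_Omega_bar\<close> multiplied by \<open>U\<close> from the left.\<close>

lemma minus_dressing_times_Omega_bar:
  fixes U :: "'a::comm_ring_1 zmat"
  shows "- ((Lambda_pow (- int k) \<star> U - U \<star> Lambda_pow (int k) - U \<star> O_neg k \<star> U) \<star> Omega_bar) =
    (Lambda_pow (- int k) - U \<star> O_neg k) \<star> g_bar U - g_bar U \<star> Lambda_pow (- int k)"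
proof -
  note [simp] = row_finite_Lambda_pow col_finite_Lambda_pow col_finite_O_neg
    col_finite_Omega_bar row_finite_times_O_neg row_finite_diff col_finite_Omega_bar_times_Lambda_pow
  define W where "W = Lambda_pow (- int k) - U \<star> O_neg k"
  \<comment> \<open>No finiteness is known for \<open>U\<close>, so the finite rows of
    \<open>W\<close> justify distributing it over \<open>g_bar U\<close> and reassociating
    \<open>W \<star> (U \<star> Omega_bar)\<close>.\<close>
  have W: "row_finite W" by (simp add: W_def)
  have "W \<star> g_bar U = W \<star> one_zmat - W \<star> U \<star> Omega_bar"
    by (simp add: g_bar_def times_zmat_diff_right times_zmat_assoc W)
  moreover have "W \<star> one_zmat = W"
    by (intro ext) (simp add: one_zmat_eq_Lambda_pow times_Lambda_pow_entry)
  moreover have "W \<star> U = Lambda_pow (- int k) \<star> U - U \<star> O_neg k \<star> U"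
    by (simp add: W_def times_zmat_diff_left)
  moreover have "g_bar U \<star> Lambda_pow (- int k) =
      Lambda_pow (- int k) - U \<star> (Omega_bar \<star> Lambda_pow (- int k))"
  proof -
    have "one_zmat \<star> Lambda_pow (- int k) = (Lambda_pow (- int k) :: 'a zmat)"
      by (intro ext) (simp add: one_zmat_eq_Lambda_pow Lambda_pow_times_entry)
    then show ?thesis
      by (simp add: g_bar_def times_zmat_diff_left times_zmat_assoc)
  qed
  moreover have "U \<star> Lambda_pow (int k) \<star> Omega_bar =
      U \<star> (Omega_bar \<star> Lambda_pow (- int k)) - U \<star> O_neg k"
    by (simp add: times_zmat_assoc Lambda_pow_times_Omega_bar times_zmat_diff_right)
  ultimately show ?thesis
    by (simp add: times_zmat_diff_left W_def) (simp add: fun_eq_iff)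
qed

text \<open>Each entry of \<open>U \<star> Omega_bar\<close> is zero or minus a single entry of
  \<open>U\<close>, so no derivative has to be exchanged with a sum.\<close>

lemma has_partial_deriv_zmat_g_bar:
  assumes "has_partial_deriv_zmat U k D t"
  shows "has_partial_deriv_zmat (\<lambda>t. g_bar (U t)) k (- (D \<star> Omega_bar)) t"
  using assms unfolding has_partial_deriv_zmat_def g_bar_def
  by (auto simp: times_Omega_bar_entry intro!: derivative_eq_intros)

theorem proposition4:
  fixes U :: "(nat \<Rightarrow> 'a::real_normed_field) \<Rightarrow> 'a zmat"
    and T :: "(nat \<Rightarrow> 'a) set"
  assumes "\<And>t k. t \<in> T \<Longrightarrow> k \<ge> 1 \<Longrightarrow>
    has_partial_deriv_zmat U k
      (Lambda_pow (- int k) \<star> U t - U t \<star> Lambda_pow (int k) - U t \<star> O_neg k \<star> U t) t"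
  shows "\<forall>t\<in>T. \<forall>k\<ge>1.
    has_partial_deriv_zmat (\<lambda>t. g_bar (U t)) k
      ((Lambda_pow (- int k) - U t \<star> O_neg k) \<star> g_bar (U t)
         - g_bar (U t) \<star> Lambda_pow (- int k)) t"
proof (intro ballI allI impI)
  fix t k
  assume "t \<in> T" and "(1::nat) \<le> k"
  from has_partial_deriv_zmat_g_bar[OF assms[OF this]]
  show "has_partial_deriv_zmat (\<lambda>t. g_bar (U t)) k
      ((Lambda_pow (- int k) - U t \<star> O_neg k) \<star> g_bar (U t)
         - g_bar (U t) \<star> Lambda_pow (- int k)) t"
    by (simp only: minus_dressing_times_Omega_bar)
qed

end
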